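(* Let $L\subset\mathbb{R}^m$ be a lattice, let $d_1,\dots,d_k$ be linearly independent vectors from $L$, and let $b_1^*,\dots,b_n^*$ be the Gram-Schmidt orthogonalization of an arbitrary basis $b_1,\dots,b_n$ of $L$. Then $$\det L(d_1,\dots,d_k) \ge \min_{1\le i_1<\dots<i_k\le n} \left\{ \|b_{i_1}^*\| \cdots \|b_{i_k}^*\| \right\}.$$
   Context: Throughout, $\langle\cdot,\cdot\rangle$ is the usual inner product on $\mathbb{R}^m$ and $\|\cdot\|$ the Euclidean norm. For linearly independent vectors $b_1,\dots,b_n\in\mathbb{R}^m$, the lattice they generate is $L(b_1,\dots,b_n)=\{\sum_{i=1}^n \lambda_i b_i : \lambda_i\in\mathbb{Z},\ i=1,\dots,n\}$, and $b_1,\dots,b_n$ is called a basis of it. The determinant of a lattice $L$ with basis matrix $B=[b_1,\dots,b_n]$ (columns $b_i$) is $\det L=\sqrt{\det(B^T B)}$, which does not depend on the choice of basis. The Gram-Schmidt orthogonalization of a basis $b_1,\dots,b_n$ consists of the vectors $b_1^*=b_1$ and $b_i^*=b_i-\sum_{j=1}^{i-1}\mu_{ij}b_j^*$ for $i=2,\dots,n$, where $\mu_{ij}=\langle b_i,b_j^*\rangle/\langle b_j^*,b_j^*\rangle$. *)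

theory Defs
  imports
    Complex_Main
    "Jordan_Normal_Form.DL_Rank"
    "Jordan_Normal_Form.Gram_Schmidt"
begin

text \<open>Points of \<open>\<real>\<^sup>m\<close> are the real vectors in \<^term>\<open>carrier_vec m\<close>; a system
  \<open>b\<^sub>1, \<dots>, b\<^sub>n\<close> is a list, so that \<open>b\<^sub>i\<close> is entry \<open>i - 1\<close>.\<close>

definition vec_norm :: "real vec \<Rightarrow> real" where
  "vec_norm v = sqrt (v \<bullet> v)"

text \<open>\<^const>\<open>module.lin_dep\<close> speaks about sets of vectors; for a list, distinctness is needed in addition.\<close>

definition lin_indep_list :: "nat \<Rightarrow> real vec list \<Rightarrow> bool" where
  "lin_indep_list m bs \<longleftrightarrow>
     set bs \<subseteq> carrier_vec m \<and> distinct bs \<and>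
     \<not> module.lin_dep class_ring (module_vec TYPE(real) m) (set bs)"

definition lattice_of :: "nat \<Rightarrow> real vec list \<Rightarrow> real vec set" where
  "lattice_of m bs =
     {module.lincomb_list (module_vec TYPE(real) m) (\<lambda>i. of_int (l i)) bs | l :: nat \<Rightarrow> int. True}"

definition lattice_basis :: "nat \<Rightarrow> real vec set \<Rightarrow> real vec list \<Rightarrow> bool" where
  "lattice_basis m L bs \<longleftrightarrow> lin_indep_list m bs \<and> L = lattice_of m bs"

text \<open>The empty list is a basis of the trivial lattice, whose determinant is \<open>1\<close>.\<close>

definition is_lattice :: "nat \<Rightarrow> real vec set \<Rightarrow> bool" where
  "is_lattice m L \<longleftrightarrow> (\<exists>bs. lattice_basis m L bs)"

definition basis_det :: "nat \<Rightarrow> real vec list \<Rightarrow> real" where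
  "basis_det m bs = sqrt (det ((mat_of_cols m bs)\<^sup>T * mat_of_cols m bs))"

text \<open>Independence of the basis is lemma \<open>lattice_det_eq\<close> below.\<close>

definition lattice_det :: "nat \<Rightarrow> real vec set \<Rightarrow> real" where
  "lattice_det m L = (THE x. \<exists>bs. lattice_basis m L bs \<and> x = basis_det m bs)"


lemma lincomb_list_mat_of_cols:
  assumes "set bs \<subseteq> carrier_vec m"
  shows "module.lincomb_list (module_vec TYPE(real) m) c bs
    = mat_of_cols m bs *\<^sub>v vec (length bs) c"
proof -
  interpret vec_space "TYPE(real)" m .
  have car: "\<And>i. i < length bs \<Longrightarrow> bs ! i \<in> carrier_vec m"
    using assms by (meson nth_mem subsetD)
  let ?xs = "map (\<lambda>i. c i \<cdot>\<^sub>v bs ! i) [0..<length bs]"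
  have xs: "set ?xs \<subseteq> carrier_vec m" using car by auto
  show ?thesis
  proof (rule eq_vecI)
    show "dim_vec (lincomb_list c bs) = dim_vec (mat_of_cols m bs *\<^sub>v vec (length bs) c)"
      using carrier_vecD[OF lincomb_list_carrier[of bs c]] assms by simp
    fix i assume "i < dim_vec (mat_of_cols m bs *\<^sub>v vec (length bs) c)"
    hence i: "i < m" by simp
    have "lincomb_list c bs $ i = (\<Sum>j = 0..<length ?xs. ?xs ! j $ i)"
      unfolding lincomb_list_def using xs i by (intro sumlist_nth) (blast intro: carrier_vecD)+
    also have "\<dots> = (\<Sum>j = 0..<length bs. bs ! j $ i * c j)"
      using carrier_vecD[OF car] i by (intro sum.cong) (simp_all add: mult.commute)
    also have "\<dots> = (mat_of_cols m bs *\<^sub>v vec (length bs) c) $ i"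
      using i by (simp add: scalar_prod_def mat_of_cols_index)
    finally show "lincomb_list c bs $ i = (mat_of_cols m bs *\<^sub>v vec (length bs) c) $ i" .
  qed
qed

lemma lattice_of_memE:
  assumes "set bs \<subseteq> carrier_vec m" "v \<in> lattice_of m bs"
  obtains l :: "nat \<Rightarrow> int" where "v = mat_of_cols m bs *\<^sub>v vec (length bs) (\<lambda>i. of_int (l i))"
  using assms unfolding lattice_of_def by (auto simp: lincomb_list_mat_of_cols)

lemma set_subset_lattice_of:
  assumes "set bs \<subseteq> carrier_vec m"
  shows "set bs \<subseteq> lattice_of m bs"
proof
  fix b assume "b \<in> set bs"
  then obtain j where j: "j < length bs" "b = bs ! j" by (auto simp: in_set_conv_nth)
  have "mat_of_cols m bs *\<^sub>v vec (length bs) (\<lambda>i. of_int (if i = j then 1 else 0 :: int))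
    = mat_of_cols m bs *\<^sub>v unit_vec (length bs) j"
    by (rule arg_cong[where f = "\<lambda>v. mat_of_cols m bs *\<^sub>v v"]) (rule eq_vecI, auto simp: unit_vec_def)
  also have "\<dots> = col (mat_of_cols m bs) j"
    using j by (intro eq_vecI) auto
  also have "\<dots> = b"
    using assms j by (subst col_mat_of_cols) auto
  finally show "b \<in> lattice_of m bs"
    unfolding lattice_of_def lincomb_list_mat_of_cols[OF assms] by force
qed

lemma subset_lattice_of_int_mat:
  assumes b: "set bs \<subseteq> carrier_vec m" and sub: "set cs \<subseteq> lattice_of m bs"
  obtains U :: "int mat" where "U \<in> carrier_mat (length bs) (length cs)"
    "mat_of_cols m cs = mat_of_cols m bs * map_mat of_int U"
proof -
  have "\<forall>j<length cs. \<exists>l :: nat \<Rightarrow> int.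
      cs ! j = mat_of_cols m bs *\<^sub>v vec (length bs) (\<lambda>i. of_int (l i))"
    using sub lattice_of_memE[OF b] by (metis nth_mem subsetD)
  then obtain l :: "nat \<Rightarrow> nat \<Rightarrow> int" where
    l: "\<And>j. j < length cs \<Longrightarrow> cs ! j = mat_of_cols m bs *\<^sub>v vec (length bs) (\<lambda>i. of_int (l j i))"
    by metis
  define U where "U = mat (length bs) (length cs) (\<lambda>(i, j). l j i)"
  have "mat_of_cols m cs = mat_of_cols m bs * map_mat of_int U"
  proof (rule eq_matI)
    fix i j assume "i < dim_row (mat_of_cols m bs * map_mat of_int U)"
      "j < dim_col (mat_of_cols m bs * map_mat of_int U)"
    hence ij: "i < m" "j < length cs" by (auto simp: U_def)
    have "map_vec real_of_int (vec (length bs) (l j)) = vec (length bs) (\<lambda>i. real_of_int (l j i))"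
      by (intro eq_vecI) auto
    then show "mat_of_cols m cs $$ (i, j) = (mat_of_cols m bs * map_mat of_int U) $$ (i, j)"
      using ij by (simp add: mat_of_cols_index l U_def)
  qed (auto simp: U_def)
  then show thesis using that[of U] by (simp add: U_def)
qed

lemma lin_indep_list_mult_cancel:
  assumes ind: "lin_indep_list m bs" and X: "X \<in> carrier_mat (length bs) (length bs)"
    and eq: "mat_of_cols m bs * X = mat_of_cols m bs"
  shows "X = 1\<^sub>m (length bs)"
proof -
  interpret vec_space "TYPE(real)" m .
  let ?n = "length bs" and ?B = "mat_of_cols m bs"
  have cols: "cols ?B = bs" using ind by (simp add: lin_indep_list_def)
  have B: "?B \<in> carrier_mat m ?n" by simp
  have inj: "v = 0\<^sub>v ?n" if "v \<in> carrier_vec ?n" "?B *\<^sub>v v = 0\<^sub>v m" for v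
    using lin_depI[OF B that(1) _ that(2)] ind unfolding cols lin_indep_list_def by auto
  have "?B * (X - 1\<^sub>m ?n) = 0\<^sub>m m ?n"
    using X B eq by (simp add: mult_minus_distrib_mat[OF B])
  hence z: "?B *\<^sub>v col (X - 1\<^sub>m ?n) j = 0\<^sub>v m" if "j < ?n" for j
    using that X B by (metis col_mult2 col_zero minus_carrier_mat one_carrier_mat)
  have c: "col (X - 1\<^sub>m ?n) j = 0\<^sub>v ?n" if "j < ?n" for j
    using X z[OF that] by (intro inj carrier_vecI) simp_all
  show ?thesis
  proof (rule eq_matI)
    fix i j assume "i < dim_row (1\<^sub>m ?n :: real mat)" "j < dim_col (1\<^sub>m ?n :: real mat)"
    hence ij: "i < ?n" "j < ?n" by auto
    have "col (X - 1\<^sub>m ?n) j $ i = 0" using c[OF ij(2)] ij by simp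
    thus "X $$ (i, j) = 1\<^sub>m ?n $$ (i, j)" using ij X by auto
  qed (use X in auto)
qed

lemma lattice_basis_length_eq:
  fixes U V :: "real mat"
  assumes U: "U \<in> carrier_mat n k" and V: "V \<in> carrier_mat k n"
    and UV: "U * V = 1\<^sub>m n" and VU: "V * U = 1\<^sub>m k"
  shows "n = k"
proof -
  have "real n = (\<Sum>i<n. (U * V) $$ (i, i))" by (simp add: UV)
  also have "\<dots> = (\<Sum>i<n. \<Sum>j<k. U $$ (i, j) * V $$ (j, i))"
    using U V by (auto simp: scalar_prod_def lessThan_atLeast0 intro!: sum.cong)
  also have "\<dots> = (\<Sum>j<k. \<Sum>i<n. V $$ (j, i) * U $$ (i, j))"
    by (subst sum.swap) (simp add: mult.commute)
  also have "\<dots> = (\<Sum>j<k. (V * U) $$ (j, j))"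
    using U V by (auto simp: scalar_prod_def lessThan_atLeast0 intro!: sum.cong)
  also have "\<dots> = real k" by (simp add: VU)
  finally show ?thesis by simp
qed

lemma basis_det_unique:
  assumes "lattice_basis m L bs" "lattice_basis m L cs"
  shows "basis_det m bs = basis_det m cs"
proof -
  let ?n = "length bs" and ?k = "length cs"
  let ?B = "mat_of_cols m bs" and ?C = "mat_of_cols m cs"
  have b: "lin_indep_list m bs" "set bs \<subseteq> carrier_vec m" "L = lattice_of m bs"
    and c: "lin_indep_list m cs" "set cs \<subseteq> carrier_vec m" "L = lattice_of m cs"
    using assms by (auto simp: lattice_basis_def lin_indep_list_def)
  obtain U0 :: "int mat" where U0: "U0 \<in> carrier_mat ?n ?k" "?C = ?B * map_mat of_int U0"
    using subset_lattice_of_int_mat[OF b(2)] set_subset_lattice_of[OF c(2)] b(3) c(3) by metis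
  obtain V0 :: "int mat" where V0: "V0 \<in> carrier_mat ?k ?n" "?B = ?C * map_mat of_int V0"
    using subset_lattice_of_int_mat[OF c(2)] set_subset_lattice_of[OF b(2)] b(3) c(3) by metis
  define U V :: "real mat" where "U = map_mat of_int U0" and "V = map_mat of_int V0"
  have B: "?B \<in> carrier_mat m ?n" and C: "?C \<in> carrier_mat m ?k"
    and U: "U \<in> carrier_mat ?n ?k" and V: "V \<in> carrier_mat ?k ?n"
    using U0 V0 by (auto simp: U_def V_def)
  have CU: "?C = ?B * U" and BV: "?B = ?C * V"
    using U0 V0 by (auto simp: U_def V_def)
  have "?B * (U * V) = ?B"
    using CU BV assoc_mult_mat[OF B U V] by simp
  hence UV: "U * V = 1\<^sub>m ?n"
    using lin_indep_list_mult_cancel[OF b(1)] U V by auto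
  have "?C * (V * U) = ?C"
    using CU BV assoc_mult_mat[OF C V U] by simp
  hence VU: "V * U = 1\<^sub>m ?k"
    using lin_indep_list_mult_cancel[OF c(1)] U V by auto
  have nk: "?k = ?n" using lattice_basis_length_eq[OF U V UV VU] by simp
  have "det U * det V = 1"
    using det_mult[of U ?n V] U V UV nk by simp
  hence "real_of_int (det U0 * det V0) = 1"
    by (simp add: U_def V_def of_int_hom.hom_det)
  hence "det U0 * det V0 = 1" by linarith
  hence "\<bar>det U0\<bar> = 1" by (metis abs_mult abs_one abs_zmult_eq_1)
  hence "det U0 * det U0 = 1" by (metis abs_mult_self_eq mult_1)
  hence dU: "det U * det U = 1"
    by (metis U_def of_int_1 of_int_hom.hom_det of_int_mult)
  have Ut: "U\<^sup>T \<in> carrier_mat ?k ?n" and Bt: "?B\<^sup>T \<in> carrier_mat ?n m" using U B by auto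
  have "?C\<^sup>T * ?C = (U\<^sup>T * ?B\<^sup>T) * (?B * U)"
    unfolding CU by (simp only: transpose_mult[OF B U])
  also have "\<dots> = U\<^sup>T * (?B\<^sup>T * (?B * U))"
    using B U by (intro assoc_mult_mat[OF Ut Bt, of _ ?k]) auto
  also have "?B\<^sup>T * (?B * U) = (?B\<^sup>T * ?B) * U"
    using assoc_mult_mat[OF Bt B U] by simp
  also have "U\<^sup>T * ((?B\<^sup>T * ?B) * U) = U\<^sup>T * (?B\<^sup>T * ?B) * U"
    using assoc_mult_mat[OF Ut _ U, of "?B\<^sup>T * ?B"] Bt B by simp
  finally have "?C\<^sup>T * ?C = U\<^sup>T * (?B\<^sup>T * ?B) * U" .
  hence "det (?C\<^sup>T * ?C) = det U\<^sup>T * det (?B\<^sup>T * ?B) * det U"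
    using B U Ut Bt nk
    by (simp add: det_mult[of "U\<^sup>T * (?B\<^sup>T * ?B)" ?n U] det_mult[of "U\<^sup>T" ?n "?B\<^sup>T * ?B"]
        mult_carrier_mat[of _ ?n ?n _ ?n] mult_carrier_mat[of _ ?n m _ ?n])
  also have "\<dots> = det (?B\<^sup>T * ?B)"
    using dU U nk by (simp add: det_transpose[of U ?n])
  finally show ?thesis by (simp add: basis_det_def)
qed

lemma lattice_det_eq:
  assumes "lattice_basis m L bs"
  shows "lattice_det m L = basis_det m bs"
  unfolding lattice_det_def using assms basis_det_unique by (intro the_equality) blast+

text \<open>The library's \<^const>\<open>gram_schmidt\<close> over the reals satisfies the usual recursion.\<close>

lemma gram_schmidt_snoc:
  "gram_schmidt m (bs @ [b]) = gram_schmidt m bs @ [adjuster m b (rev (gram_schmidt m bs)) + b]"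
proof -
  have "gram_schmidt_sub m us (bs @ [b]) =
      (adjuster m b (gram_schmidt_sub m us bs) + b) # gram_schmidt_sub m us bs" for us
    by (induction bs arbitrary: us) auto
  thus ?thesis by (simp add: gram_schmidt_def)
qed

lemma adjuster_real:
  fixes w :: "real vec"
  assumes "set us \<subseteq> carrier_vec m" "i < m"
  shows "dim_vec (adjuster m w us) = m"
    and "adjuster m w us $ i = - (\<Sum>j<length us. (w \<bullet> us ! j) / (us ! j \<bullet> us ! j) * us ! j $ i)"
proof -
  have conj: "conjugate v = v" for v :: "real vec" by (intro eq_vecI) auto
  have "dim_vec (adjuster m w us) = m \<and>
    adjuster m w us $ i = - (\<Sum>j<length us. (w \<bullet> us ! j) / (us ! j \<bullet> us ! j) * us ! j $ i)"
    using assms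
  proof (induction us)
    case (Cons u us)
    then show ?case
      unfolding length_Cons sum.lessThan_Suc_shift by (auto simp: conj)
  qed auto
  thus "dim_vec (adjuster m w us) = m"
    and "adjuster m w us $ i = - (\<Sum>j<length us. (w \<bullet> us ! j) / (us ! j \<bullet> us ! j) * us ! j $ i)"
    by auto
qed

lemma gram_schmidt_carrier:
  fixes bs :: "real vec list"
  assumes "set bs \<subseteq> carrier_vec m"
  shows "length (gram_schmidt m bs) = length bs \<and> set (gram_schmidt m bs) \<subseteq> carrier_vec m"
  using assms
proof (induction bs rule: rev_induct)
  case Nil
  then show ?case by (simp add: gram_schmidt_def)
next
  case (snoc b bs)
  then have "adjuster m b us + b \<in> carrier_vec m" for us by (intro carrier_vecI) auto
  with snoc show ?case by (simp add: gram_schmidt_snoc)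
qed

lemma gram_schmidt_nth:
  fixes bs :: "real vec list"
  assumes "set bs \<subseteq> carrier_vec m" "i < length bs"
  defines "gs \<equiv> gram_schmidt m bs"
  shows "gs ! i = bs ! i - vec m (\<lambda>r. \<Sum>j<i. (bs ! i \<bullet> gs ! j) / (gs ! j \<bullet> gs ! j) * gs ! j $ r)"
  using assms(1,2) unfolding gs_def
proof (induction bs rule: rev_induct)
  case (snoc b bs)
  let ?g = "gram_schmidt m bs"
  have bs: "set bs \<subseteq> carrier_vec m" and b: "dim_vec b = m" using snoc.prems by auto
  have g: "length ?g = length bs" "set ?g \<subseteq> carrier_vec m"
    using gram_schmidt_carrier[OF bs] by auto
  show ?case
  proof (cases "i < length bs")
    case True
    then show ?thesis
      using snoc.IH[OF bs True] g by (simp add: gram_schmidt_snoc nth_append)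
  next
    case False
    hence i: "i = length bs" using snoc.prems by simp
    have "adjuster m b (rev ?g) + b
      = b - vec m (\<lambda>r. \<Sum>j<length bs. (b \<bullet> ?g ! j) / (?g ! j \<bullet> ?g ! j) * ?g ! j $ r)"
    proof (rule eq_vecI)
      fix r assume "r < dim_vec (b - vec m (\<lambda>r. \<Sum>j<length bs. (b \<bullet> ?g ! j) / (?g ! j \<bullet> ?g ! j) * ?g ! j $ r))"
      hence r: "r < m" by simp
      have "(\<Sum>j<length bs. (b \<bullet> rev ?g ! j) / (rev ?g ! j \<bullet> rev ?g ! j) * rev ?g ! j $ r)
        = (\<Sum>j<length bs. (b \<bullet> ?g ! j) / (?g ! j \<bullet> ?g ! j) * ?g ! j $ r)"
        by (subst (2) sum.nat_diff_reindex[symmetric]) (auto simp: rev_nth g intro!: sum.cong)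
      then show "(adjuster m b (rev ?g) + b) $ r
        = (b - vec m (\<lambda>r. \<Sum>j<length bs. (b \<bullet> ?g ! j) / (?g ! j \<bullet> ?g ! j) * ?g ! j $ r)) $ r"
        using r b g adjuster_real(2)[of "rev ?g" m r b] by simp
    qed (use b in auto)
    then show ?thesis
      by (simp add: i gram_schmidt_snoc nth_append g)
  qed
qed simp

end

theory Submission
  imports Defs
begin

text \<open>
  Two facts turn the inequality into a comparison of Gram-Schmidt norms. The determinant of a
  lattice is the product of the norms of the Gram-Schmidt vectors of any of its bases
  (\<open>basis_det_eq_prod_norms\<close>), and it depends on the lattice only, so that the basis
  \<open>d\<^sub>1, \<dots>, d\<^sub>k\<close> of the sublattice may be replaced by a better one.

  The proof is an induction on \<open>n\<close>. Put \<open>w = b\<^sub>n\<^sup>*\<close>, which is orthogonal to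
  \<open>b\<^sub>1, \<dots>, b\<^sub>n\<^sub>-\<^sub>1\<close> and satisfies \<open>\<langle>b\<^sub>n, w\<rangle> = \<langle>w, w\<rangle>\<close>. For \<open>v \<in> L\<close> the number
  \<open>\<langle>v, w\<rangle> / \<langle>w, w\<rangle>\<close> is therefore the coefficient of \<open>b\<^sub>n\<close> in \<open>v\<close>, an integer, and it vanishes
  exactly on \<open>L(b\<^sub>1, \<dots>, b\<^sub>n\<^sub>-\<^sub>1)\<close>. The Euclidean algorithm, run on the coefficients of the
  \<open>d\<^sub>i\<close>, produces a basis of \<open>L(d\<^sub>1, \<dots>, d\<^sub>k)\<close> in which at most the last vector \<open>d\<close> has a
  nonzero coefficient \<open>c\<close> (\<open>lattice_basis_concentrate\<close>).

  If that coefficient is zero as well, the whole basis lies in \<open>L(b\<^sub>1, \<dots>, b\<^sub>n\<^sub>-\<^sub>1)\<close> and the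
  induction hypothesis gives the indices. Otherwise the induction hypothesis for the other
  \<open>k - 1\<close> vectors gives \<open>k - 1\<close> indices below \<open>n\<close>, and \<open>n\<close> itself is the last index: the
  last Gram-Schmidt vector \<open>d\<^sup>*\<close> differs from \<open>d\<close> by a combination of vectors orthogonal to
  \<open>w\<close>, so \<open>\<langle>d\<^sup>*, w\<rangle> = c \<langle>w, w\<rangle>\<close> with \<open>\<bar>c\<bar> \<ge> 1\<close>, and hence \<open>\<parallel>d\<^sup>*\<parallel> \<ge> \<parallel>w\<parallel>\<close>
  (\<open>norm_le_if_scalar_prod_multiple\<close>).
\<close>

section \<open>Linearly independent lists\<close>

text \<open>A kernel criterion covers distinctness of the list and independence of its set at once:
  two equal entries put the difference of two unit vectors into the kernel.\<close>

lemma lin_indep_list_iff_kernel: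
  "lin_indep_list m bs \<longleftrightarrow> set bs \<subseteq> carrier_vec m \<and>
    (\<forall>v \<in> carrier_vec (length bs). mat_of_cols m bs *\<^sub>v v = 0\<^sub>v m \<longrightarrow> v = 0\<^sub>v (length bs))"
    (is "_ \<longleftrightarrow> _ \<and> ?K")
proof (cases "set bs \<subseteq> carrier_vec m")
  case True
  interpret vec_space "TYPE(real)" m .
  let ?n = "length bs" and ?B = "mat_of_cols m bs"
  have B: "?B \<in> carrier_mat m ?n" and cols: "cols ?B = bs" using True by simp_all
  have "distinct bs" if K: ?K
  proof (rule ccontr)
    assume "\<not> distinct bs"
    then obtain i j where ij: "i < ?n" "j < ?n" "i \<noteq> j" "bs ! i = bs ! j"
      by (auto simp: distinct_conv_nth)
    then have bsi: "bs ! j \<in> carrier_vec m" using True by (meson nth_mem subsetD)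
    have "?B *\<^sub>v unit_vec ?n k = col ?B k" if "k < ?n" for k
      using that by (intro eq_vecI) auto
    then have "?B *\<^sub>v (unit_vec ?n i - unit_vec ?n j) = col ?B i - col ?B j"
      using ij by (subst mult_minus_distrib_mat_vec[OF B]) auto
    also have "\<dots> = 0\<^sub>v m"
      using ij bsi by (simp add: col_mat_of_cols)
    finally have "unit_vec ?n i - unit_vec ?n j = (0\<^sub>v ?n :: real vec)" using K by simp
    then have "(unit_vec ?n i - unit_vec ?n j) $ i = (0 :: real)" using ij by simp
    then show False using ij by simp
  qed
  moreover have "\<not> lin_dep (set bs) \<longleftrightarrow> ?K" if "distinct bs"
    using lin_depI[OF B] lin_depE[OF B] that unfolding cols by blast
  ultimately show ?thesis using True by (auto simp: lin_indep_list_def)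
qed (simp add: lin_indep_list_def)

lemma lin_indep_list_append1:
  assumes "lin_indep_list m (bs @ cs)"
  shows "lin_indep_list m bs"
proof -
  interpret vec_space "TYPE(real)" m .
  have ind: "\<not> lin_dep (set (bs @ cs))" using assms unfolding lin_indep_list_def by blast
  have "\<not> lin_dep (set bs)" by (rule subset_li_is_li[OF ind]) simp
  moreover have "set bs \<subseteq> carrier_vec m" "distinct bs"
    using assms by (auto simp: lin_indep_list_def)
  ultimately show ?thesis unfolding lin_indep_list_def by blast
qed

lemma lin_indep_list_nonzero:
  assumes "lin_indep_list m bs"
  shows "0\<^sub>v m \<notin> set bs"
proof -
  interpret vec_space "TYPE(real)" m .
  show ?thesis using assms zero_lin_dep[of "set bs"] by (metis lin_indep_list_def UNIV_I one_neq_zero singletonD)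
qed

section \<open>Lattices and change of basis\<close>

lemma lattice_of_memI:
  assumes "set bs \<subseteq> carrier_vec m"
  shows "mat_of_cols m bs *\<^sub>v vec (length bs) (\<lambda>i. of_int (l i)) \<in> lattice_of m bs"
  using assms unfolding lattice_of_def by (auto simp: lincomb_list_mat_of_cols)

lemma lattice_of_carrier:
  assumes "set bs \<subseteq> carrier_vec m"
  shows "lattice_of m bs \<subseteq> carrier_vec m"
  by (auto elim!: lattice_of_memE[OF assms] intro!: carrier_vecI)

lemma lattice_of_add_smult:
  assumes bs: "set bs \<subseteq> carrier_vec m" and "v \<in> lattice_of m bs" "u \<in> lattice_of m bs"
  shows "v + of_int q \<cdot>\<^sub>v u \<in> lattice_of m bs"
proof -
  let ?B = "mat_of_cols m bs" and ?n = "length bs"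
  obtain l k :: "nat \<Rightarrow> int" where
    l: "v = ?B *\<^sub>v vec ?n (\<lambda>i. of_int (l i))" and k: "u = ?B *\<^sub>v vec ?n (\<lambda>i. of_int (k i))"
    using assms by (metis lattice_of_memE)
  have "vec ?n (\<lambda>i. real_of_int (l i + q * k i))
      = vec ?n (\<lambda>i. of_int (l i)) + of_int q \<cdot>\<^sub>v vec ?n (\<lambda>i. of_int (k i))"
    by (intro eq_vecI) auto
  then have "v + of_int q \<cdot>\<^sub>v u = ?B *\<^sub>v vec ?n (\<lambda>i. of_int (l i + q * k i))"
    unfolding l k
    by (subst mult_mat_vec[of ?B m ?n, symmetric])
      (simp_all add: mult_add_distrib_mat_vec[of ?B m ?n])
  then show ?thesis using lattice_of_memI[OF bs] by metis
qed

lemma lattice_of_subset: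
  assumes cs: "set cs \<subseteq> carrier_vec m" and bs: "set bs \<subseteq> carrier_vec m"
    and sub: "set cs \<subseteq> lattice_of m bs"
  shows "lattice_of m cs \<subseteq> lattice_of m bs"
proof
  let ?B = "mat_of_cols m bs" and ?n = "length bs" and ?k = "length cs"
  fix v assume "v \<in> lattice_of m cs"
  then obtain l :: "nat \<Rightarrow> int" where l: "v = mat_of_cols m cs *\<^sub>v vec ?k (\<lambda>i. of_int (l i))"
    using lattice_of_memE[OF cs] by metis
  obtain U :: "int mat" where U: "U \<in> carrier_mat ?n ?k"
    and CU: "mat_of_cols m cs = ?B * map_mat of_int U"
    using subset_lattice_of_int_mat[OF bs sub] by metis
  have "map_mat real_of_int U *\<^sub>v vec ?k (\<lambda>i. of_int (l i)) = map_vec of_int (U *\<^sub>v vec ?k l)"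
    using U by (intro eq_vecI) (auto simp: scalar_prod_def)
  also have "\<dots> = vec ?n (\<lambda>i. of_int ((U *\<^sub>v vec ?k l) $ i))"
    using U by (intro eq_vecI) auto
  finally have "v = ?B *\<^sub>v vec ?n (\<lambda>i. of_int ((U *\<^sub>v vec ?k l) $ i))"
    unfolding l CU using U by (subst assoc_mult_mat_vec[of ?B m ?n _ ?k]) auto
  then show "v \<in> lattice_of m bs" using lattice_of_memI[OF bs] by metis
qed

lemma lattice_of_snocE:
  assumes bs: "set (bs @ [b]) \<subseteq> carrier_vec m" and v: "v \<in> lattice_of m (bs @ [b])"
  obtains u q where "u \<in> lattice_of m bs" "v = u + of_int q \<cdot>\<^sub>v b"
proof -
  let ?n = "length bs"
  obtain l :: "nat \<Rightarrow> int" where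
    l: "v = mat_of_cols m (bs @ [b]) *\<^sub>v vec (length (bs @ [b])) (\<lambda>i. of_int (l i))"
    using lattice_of_memE[OF bs v] by metis
  have "v = mat_of_cols m bs *\<^sub>v vec ?n (\<lambda>i. of_int (l i)) + of_int (l ?n) \<cdot>\<^sub>v b"
    unfolding l using bs by (intro eq_vecI) (auto simp: scalar_prod_def mat_of_cols_index nth_append)
  moreover have "mat_of_cols m bs *\<^sub>v vec ?n (\<lambda>i. of_int (l i)) \<in> lattice_of m bs"
    using lattice_of_memI[of bs m] bs by simp
  ultimately show thesis using that by blast
qed

lemma lattice_of_Nil: "lattice_of m [] = {0\<^sub>v m}"
proof -
  have "mat_of_cols m [] *\<^sub>v vec 0 c = (0\<^sub>v m :: real vec)" for c :: "nat \<Rightarrow> real"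
    by (intro eq_vecI) (auto simp: scalar_prod_def)
  then show ?thesis unfolding lattice_of_def by (auto simp: lincomb_list_mat_of_cols)
qed

text \<open>This spares every change of basis below a separate proof of independence. The integer matrix
  \<open>U\<close> that expresses the new system by the basis has a right inverse, because the basis is
  expressible by the new system and has unique coordinates. As \<open>U\<close> is square, it is
  invertible, and the kernel of the new system is trivial too.\<close>

lemma lattice_basis_same_length:
  assumes ds: "lattice_basis m L ds" and es: "set es \<subseteq> carrier_vec m"
    and L: "L = lattice_of m es" and len: "length es = length ds"
  shows "lattice_basis m L es"
proof -
  let ?k = "length ds" and ?D = "mat_of_cols m ds" and ?E = "mat_of_cols m es"
  have d: "lin_indep_list m ds" "set ds \<subseteq> carrier_vec m" "L = lattice_of m ds"
    using ds by (auto simp: lattice_basis_def lin_indep_list_def)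
  have "set es \<subseteq> lattice_of m ds" using set_subset_lattice_of[OF es] d(3) L by simp
  from subset_lattice_of_int_mat[OF d(2) this] obtain U0 :: "int mat" where
    U0: "U0 \<in> carrier_mat ?k ?k" "?E = ?D * map_mat of_int U0" by (metis len)
  have "set ds \<subseteq> lattice_of m es" using set_subset_lattice_of[OF d(2)] d(3) L by simp
  from subset_lattice_of_int_mat[OF es this] obtain V0 :: "int mat" where
    V0: "V0 \<in> carrier_mat ?k ?k" "?D = ?E * map_mat of_int V0" by (metis len)
  define U V :: "real mat" where "U = map_mat of_int U0" and "V = map_mat of_int V0"
  have U: "U \<in> carrier_mat ?k ?k" "?E = ?D * U" and V: "V \<in> carrier_mat ?k ?k" "?D = ?E * V"
    using U0 V0 by (simp_all add: U_def V_def)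
  have D: "?D \<in> carrier_mat m ?k" by simp
  have "?D * (U * V) = ?D" using U V assoc_mult_mat[OF D U(1) V(1)] by simp
  then have "U * V = 1\<^sub>m ?k" using lin_indep_list_mult_cancel[OF d(1)] mult_carrier_mat[OF U(1) V(1)] by blast
  then have VU: "V * U = 1\<^sub>m ?k" using mat_mult_left_right_inverse[OF U(1) V(1)] by blast
  have "v = 0\<^sub>v ?k" if v: "v \<in> carrier_vec ?k" "?E *\<^sub>v v = 0\<^sub>v m" for v
  proof -
    have "?D *\<^sub>v (U *\<^sub>v v) = 0\<^sub>v m" using v(2) U(2) assoc_mult_mat_vec[OF D U(1) v(1)] by simp
    then have "U *\<^sub>v v = 0\<^sub>v ?k" using d(1) U(1) v(1) by (simp add: lin_indep_list_iff_kernel)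
    then have "V *\<^sub>v (U *\<^sub>v v) = 0\<^sub>v ?k" using V(1) by auto
    then show ?thesis using VU v(1) assoc_mult_mat_vec[OF V(1) U(1) v(1)] by simp
  qed
  then have "lin_indep_list m es" using es len by (simp add: lin_indep_list_iff_kernel)
  then show ?thesis using L by (simp add: lattice_basis_def)
qed

section \<open>Euclidean reduction of a lattice basis\<close>

text \<open>The Euclidean algorithm in its subtractive form: as long as two basis vectors have nonzero
  integer product with \<open>w\<close>, adding or subtracting the one with the smaller product makes the
  larger product strictly smaller in absolute value, and this does not change the lattice. At the
  end at most one vector with nonzero product remains, and it can be moved to the end.\<close>

lemma lattice_basis_concentrate:
  assumes ds: "lattice_basis m L ds" and w: "w \<in> carrier_vec m"
    and int: "\<And>v. v \<in> L \<Longrightarrow> v \<bullet> w \<in> \<int>"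
  obtains es where "lattice_basis m L es" "length es = length ds"
    "\<And>e. e \<in> set (butlast es) \<Longrightarrow> e \<bullet> w = 0"
  using ds
proof (induction "\<Sum>d\<leftarrow>ds. nat \<lfloor>\<bar>d \<bullet> w\<bar>\<rfloor>" arbitrary: ds thesis rule: less_induct)
  case less
  have d: "lin_indep_list m ds" "set ds \<subseteq> carrier_vec m" "L = lattice_of m ds"
    using less.prems(2) by (auto simp: lattice_basis_def lin_indep_list_def)
  have dL: "ds ! i \<in> L" "ds ! i \<in> carrier_vec m" if "i < length ds" for i
    using set_subset_lattice_of[OF d(2)] that d by auto
  consider (single) i where "i < length ds" "\<And>j. j < length ds \<Longrightarrow> j \<noteq> i \<Longrightarrow> ds ! j \<bullet> w = 0"
    | (none) "ds = []"
    | (pair) i j where "i < length ds" "j < length ds" "i \<noteq> j" "ds ! i \<bullet> w \<noteq> 0"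
        "\<bar>ds ! i \<bullet> w\<bar> \<le> \<bar>ds ! j \<bullet> w\<bar>"
    by (metis length_greater_0_conv linorder_linear)
  then show ?case
  proof cases
    case single
    define es where "es = (take i ds @ drop (Suc i) ds) @ [ds ! i]"
    have "set ds = set (take i ds @ ds ! i # drop (Suc i) ds)"
      using single(1) by (simp flip: id_take_nth_drop)
    then have set: "set es = set ds" by (auto simp: es_def)
    have len: "length es = length ds" using single(1) by (simp add: es_def)
    have esc: "set es \<subseteq> carrier_vec m" using set d by simp
    have "L = lattice_of m es"
      using set d lattice_of_subset[OF esc d(2)] lattice_of_subset[OF d(2) esc]
        set_subset_lattice_of[OF esc] set_subset_lattice_of[OF d(2)] by auto
    then have b: "lattice_basis m L es"
      using lattice_basis_same_length[OF less.prems(2) esc _ len] by blast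
    have "e \<bullet> w = 0" if "e \<in> set (butlast es)" for e
    proof -
      have "butlast es = take i ds @ drop (Suc i) ds" unfolding es_def by (rule butlast_snoc)
      with that consider "e \<in> set (take i ds)" | "e \<in> set (drop (Suc i) ds)"
        by auto
      then show ?thesis
      proof cases
        case 1
        then show ?thesis using single(2) by (auto simp: in_set_conv_nth)
      next
        case 2
        then obtain l where "l < length ds - Suc i" "e = ds ! (Suc i + l)"
          by (auto simp: in_set_conv_nth)
        then show ?thesis using single(2)[of "Suc i + l"] by simp
      qed
    qed
    then show thesis using less.prems(1) b len by blast
  next
    case none
    then show thesis using less.prems by force
  next
    case pair
    obtain x y :: int where x: "ds ! i \<bullet> w = of_int x" and y: "ds ! j \<bullet> w = of_int y"
      using int dL(1) pair(1,2) by (metis Ints_cases)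
    \<comment> \<open>The signs are chosen so that \<open>\<bar>y + q * x\<bar> = \<bar>y\<bar> - \<bar>x\<bar>\<close>.\<close>
    define q where "q = - sgn x * sgn y"
    define e where "e = ds ! j + of_int q \<cdot>\<^sub>v ds ! i"
    define es where "es = ds[j := e]"
    have len: "length es = length ds" by (simp add: es_def)
    have xy: "x \<noteq> 0" "\<bar>x\<bar> \<le> \<bar>y\<bar>" using pair x y by auto
    have "\<bar>y + q * x\<bar> < \<bar>y\<bar>" using xy by (auto simp: q_def sgn_if abs_if split: if_splits)
    moreover have "e \<bullet> w = of_int (y + q * x)"
      using dL(2)[OF pair(1)] dL(2)[OF pair(2)] w x y
      by (simp add: e_def add_scalar_prod_distrib[of _ m] smult_scalar_prod_distrib[of _ m])
    moreover have "nat \<lfloor>\<bar>real_of_int z\<bar>\<rfloor> = nat \<bar>z\<bar>" for z by (metis floor_of_int of_int_abs)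
    ultimately have dec: "nat \<lfloor>\<bar>e \<bullet> w\<bar>\<rfloor> < nat \<lfloor>\<bar>ds ! j \<bullet> w\<bar>\<rfloor>"
      unfolding y by (simp del: of_int_add of_int_mult)
    have smaller: "(\<Sum>d\<leftarrow>es. nat \<lfloor>\<bar>d \<bullet> w\<bar>\<rfloor>) < (\<Sum>d\<leftarrow>ds. nat \<lfloor>\<bar>d \<bullet> w\<bar>\<rfloor>)"
    proof -
      have "nat \<lfloor>\<bar>ds ! j \<bullet> w\<bar>\<rfloor> \<le> (\<Sum>d\<leftarrow>ds. nat \<lfloor>\<bar>d \<bullet> w\<bar>\<rfloor>)"
        using pair(2) by (intro member_le_sum_list) auto
      moreover have "(\<Sum>d\<leftarrow>es. nat \<lfloor>\<bar>d \<bullet> w\<bar>\<rfloor>)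
          = (\<Sum>d\<leftarrow>ds. nat \<lfloor>\<bar>d \<bullet> w\<bar>\<rfloor>) + nat \<lfloor>\<bar>e \<bullet> w\<bar>\<rfloor> - nat \<lfloor>\<bar>ds ! j \<bullet> w\<bar>\<rfloor>"
        using pair(2) by (simp add: es_def map_update sum_list_update)
      ultimately show ?thesis using dec by linarith
    qed
    have eL: "e \<in> lattice_of m ds"
      unfolding e_def using dL pair d by (intro lattice_of_add_smult) auto
    have esL: "set es \<subseteq> lattice_of m ds"
      using eL set_subset_lattice_of[OF d(2)] set_update_subset_insert[of ds j e]
      by (auto simp: es_def)
    then have esc: "set es \<subseteq> carrier_vec m" using lattice_of_carrier[OF d(2)] by blast
    have esi: "es ! l \<in> lattice_of m es" if "l < length ds" for l
      using set_subset_lattice_of[OF esc] that len by (metis nth_mem subsetD)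
    have "ds ! l \<in> lattice_of m es" if l: "l < length ds" for l
    proof (cases "l = j")
      case True
      have "ds ! j = es ! j + of_int (- q) \<cdot>\<^sub>v es ! i"
        using pair dL(2)[OF pair(1)] dL(2)[OF pair(2)]
        by (intro eq_vecI) (auto simp: es_def e_def)
      then show ?thesis
        using True lattice_of_add_smult[OF esc esi[OF pair(2)] esi[OF pair(1)]] by metis
    next
      case False
      then show ?thesis using esi[OF l] by (simp add: es_def)
    qed
    then have "set ds \<subseteq> lattice_of m es" by (auto simp: in_set_conv_nth)
    then have "L = lattice_of m es"
      using esL d lattice_of_subset[OF esc d(2)] lattice_of_subset[OF d(2) esc] by auto
    then have "lattice_basis m L es"
      using lattice_basis_same_length[OF less.prems(2) esc _ len] by blast
    then show thesis using less.hyps[OF smaller] less.prems(1) len by metis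
  qed
qed

section \<open>Gram-Schmidt orthogonalization and determinants\<close>

lemma gram_schmidt_nth_carrier:
  fixes bs :: "real vec list"
  assumes "set bs \<subseteq> carrier_vec m" "i < length bs"
  shows "gram_schmidt m bs ! i \<in> carrier_vec m"
  using gram_schmidt_carrier[OF assms(1)] assms(2) by (metis nth_mem subsetD)

lemma gram_schmidt_scalar_prod:
  fixes bs :: "real vec list"
  assumes bs: "set bs \<subseteq> carrier_vec m" and i: "i < length bs" and w: "w \<in> carrier_vec m"
  defines "gs \<equiv> gram_schmidt m bs"
  shows "gs ! i \<bullet> w = bs ! i \<bullet> w
    - (\<Sum>j<i. (bs ! i \<bullet> gs ! j) / (gs ! j \<bullet> gs ! j) * (gs ! j \<bullet> w))"
proof -
  let ?\<mu> = "\<lambda>j. (bs ! i \<bullet> gs ! j) / (gs ! j \<bullet> gs ! j)"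
  let ?p = "vec m (\<lambda>r. \<Sum>j<i. ?\<mu> j * gs ! j $ r)"
  have "gs ! i = bs ! i - ?p" unfolding gs_def by (rule gram_schmidt_nth[OF bs i])
  moreover have "bs ! i \<in> carrier_vec m" using bs i by auto
  ultimately have "gs ! i \<bullet> w = bs ! i \<bullet> w - ?p \<bullet> w"
    using w by (simp add: minus_scalar_prod_distrib[of _ m])
  also have "?p \<bullet> w = (\<Sum>r<m. \<Sum>j<i. ?\<mu> j * (gs ! j $ r * w $ r))"
    using w by (simp add: scalar_prod_def sum_distrib_right lessThan_atLeast0 mult.assoc)
  also have "\<dots> = (\<Sum>j<i. ?\<mu> j * (gs ! j \<bullet> w))"
    using w by (subst sum.swap) (simp add: scalar_prod_def sum_distrib_left lessThan_atLeast0)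
  finally show ?thesis .
qed

lemma gram_schmidt_orthogonal:
  assumes bs: "lin_indep_list m bs" and ij: "i < length bs" "j < length bs"
  shows "gram_schmidt m bs ! i \<bullet> gram_schmidt m bs ! j = 0 \<longleftrightarrow> i \<noteq> j"
proof -
  interpret cof_vec_space m "TYPE(real)" .
  have "corthogonal (gram_schmidt m bs)"
    using bs by (intro gram_schmidt_result(2)) (auto simp: lin_indep_list_def)
  moreover have "length (gram_schmidt m bs) = length bs"
    using bs gram_schmidt_carrier by (simp add: lin_indep_list_def)
  ultimately show ?thesis using ij by (auto dest: corthogonalD)
qed

text \<open>The vector \<open>b\<^sub>i\<close> differs from \<open>b\<^sub>i\<^sup>*\<close> by a combination of earlier Gram-Schmidt vectors, all
  orthogonal to \<open>b\<^sub>j\<^sup>*\<close>. For \<open>i < j\<close> both sides are zero; for \<open>i = j\<close> the common value is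
  \<open>\<parallel>b\<^sub>j\<^sup>*\<parallel>\<^sup>2\<close>.\<close>

lemma scalar_prod_later_gram_schmidt:
  assumes bs: "lin_indep_list m bs" and ij: "i \<le> j" "j < length bs"
  shows "bs ! i \<bullet> gram_schmidt m bs ! j = gram_schmidt m bs ! i \<bullet> gram_schmidt m bs ! j"
proof -
  have c: "set bs \<subseteq> carrier_vec m" using bs by (simp add: lin_indep_list_def)
  have i: "i < length bs" using ij by simp
  have "gram_schmidt m bs ! l \<bullet> gram_schmidt m bs ! j = 0" if "l < i" for l
    using gram_schmidt_orthogonal[OF bs, of l j] ij that by simp
  then show ?thesis
    by (simp add: gram_schmidt_scalar_prod[OF c i gram_schmidt_nth_carrier[OF c ij(2)]])
qed

text \<open>The vectors subtracted from \<open>b\<^sub>i\<close> lie in the span of \<open>b\<^sub>1, \<dots>, b\<^sub>i\<^sub>-\<^sub>1\<close>, hence are orthogonal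
  to \<open>w\<close>.\<close>

lemma gram_schmidt_scalar_prod_perp:
  fixes bs :: "real vec list"
  assumes bs: "set bs \<subseteq> carrier_vec m" and w: "w \<in> carrier_vec m"
    and perp: "\<And>j. j < i \<Longrightarrow> bs ! j \<bullet> w = 0" and i: "i < length bs"
  shows "gram_schmidt m bs ! i \<bullet> w = bs ! i \<bullet> w"
  using perp i
proof (induction i rule: less_induct)
  case (less i)
  have "gram_schmidt m bs ! j \<bullet> w = 0" if "j < i" for j
    using less.IH[OF that] less.prems that by simp
  then show ?case using gram_schmidt_scalar_prod[OF bs less.prems(2) w] by simp
qed

text \<open>The orthogonalization is a factorization \<open>B = G R\<close> with \<open>R\<close> unit upper triangular, so
  \<open>B\<^sup>T B = R\<^sup>T (G\<^sup>T G) R\<close> has the determinant of the diagonal matrix \<open>G\<^sup>T G\<close>.\<close>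

lemma basis_det_eq_prod_norms:
  assumes "lin_indep_list m bs"
  shows "basis_det m bs = prod_list (map vec_norm (gram_schmidt m bs))"
proof -
  define gs where "gs = gram_schmidt m bs"
  let ?n = "length bs" and ?B = "mat_of_cols m bs" and ?G = "mat_of_cols m gs"
  have bs: "set bs \<subseteq> carrier_vec m" using assms by (simp add: lin_indep_list_def)
  have gs: "length gs = ?n" "set gs \<subseteq> carrier_vec m"
    using gram_schmidt_carrier[OF bs] by (simp_all add: gs_def)
  have car: "bs ! i \<in> carrier_vec m" "gs ! i \<in> carrier_vec m" if "i < ?n" for i
    using bs gs that by (metis nth_mem subsetD)+
  define R where "R = mat ?n ?n (\<lambda>(j, i). if j < i then (bs ! i \<bullet> gs ! j) / (gs ! j \<bullet> gs ! j)
    else if j = i then 1 else 0)"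
  have R: "R \<in> carrier_mat ?n ?n" and G: "?G \<in> carrier_mat m ?n"
    using mat_of_cols_carrier(1)[of m gs] by (simp_all only: R_def gs mat_carrier)
  have Rt: "R\<^sup>T \<in> carrier_mat ?n ?n" and Gt: "?G\<^sup>T \<in> carrier_mat ?n m" using R G by auto
  have BGR: "?B = ?G * R"
  proof (rule eq_matI)
    fix r i assume "r < dim_row (?G * R)" "i < dim_col (?G * R)"
    then have ri: "r < m" "i < ?n" by (simp_all add: R_def)
    let ?\<mu> = "\<lambda>j. (bs ! i \<bullet> gs ! j) / (gs ! j \<bullet> gs ! j)"
    have "{..<?n} = {..<i} \<union> {i} \<union> {i<..<?n}" using ri by auto
    moreover have "(?G * R) $$ (r, i) = (\<Sum>j<?n. gs ! j $ r * R $$ (j, i))"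
      using ri gs by (simp add: R_def scalar_prod_def mat_of_cols_index lessThan_atLeast0)
    ultimately have "(?G * R) $$ (r, i) = (\<Sum>j\<in>{..<i} \<union> {i} \<union> {i<..<?n}. gs ! j $ r * R $$ (j, i))"
      by simp
    also have "\<dots> = (\<Sum>j<i. gs ! j $ r * R $$ (j, i)) + gs ! i $ r * R $$ (i, i)
        + (\<Sum>j\<in>{i<..<?n}. gs ! j $ r * R $$ (j, i))"
      by (subst sum.union_disjoint; (subst sum.union_disjoint)?) auto
    also have "\<dots> = (\<Sum>j<i. ?\<mu> j * gs ! j $ r) + gs ! i $ r"
      using ri by (simp add: R_def mult.commute)
    also have "\<dots> = bs ! i $ r"
      using ri car[of i] gram_schmidt_nth[OF bs ri(2)] by (simp add: gs_def)
    finally show "?B $$ (r, i) = (?G * R) $$ (r, i)" using ri by (simp add: mat_of_cols_index)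
  qed (simp_all add: R_def)
  have diag: "?G\<^sup>T * ?G = mat_diag ?n (\<lambda>i. gs ! i \<bullet> gs ! i)"
    using gram_schmidt_orthogonal[OF assms] gs car
    by (intro eq_matI) (auto simp: mat_diag_def gs_def[symmetric])
  have detR: "det R = 1"
  proof -
    have "det R = prod_list (diag_mat R)"
      using R by (intro det_upper_triangular) (auto simp: R_def)
    also have "\<dots> = 1" by (simp add: prod_list_diag_prod R_def)
    finally show ?thesis .
  qed
  have sqrt_prod: "sqrt (prod f A) = (\<Prod>i\<in>A. sqrt (f i))" for f :: "nat \<Rightarrow> real" and A
    by (induction A rule: infinite_finite_induct) (auto simp: real_sqrt_mult)
  have "?B\<^sup>T * ?B = (R\<^sup>T * ?G\<^sup>T) * (?G * R)"
    unfolding BGR by (simp only: transpose_mult[OF G R])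
  also have "\<dots> = R\<^sup>T * (?G\<^sup>T * (?G * R))"
    using R G by (intro assoc_mult_mat[OF Rt Gt, of _ ?n]) auto
  also have "?G\<^sup>T * (?G * R) = mat_diag ?n (\<lambda>i. gs ! i \<bullet> gs ! i) * R"
    using assoc_mult_mat[OF Gt G R] diag by simp
  finally have "det (?B\<^sup>T * ?B) = det R\<^sup>T * (det (mat_diag ?n (\<lambda>i. gs ! i \<bullet> gs ! i)) * det R)"
    using R Rt by (simp add: det_mult[of _ ?n] mult_carrier_mat[of _ ?n ?n])
  also have "\<dots> = det (mat_diag ?n (\<lambda>i. gs ! i \<bullet> gs ! i))"
    using R detR by (simp add: det_transpose[OF R])
  also have "\<dots> = prod_list (diag_mat (mat_diag ?n (\<lambda>i. gs ! i \<bullet> gs ! i)))"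
    by (intro det_upper_triangular[of _ ?n]) (auto simp: mat_diag_def)
  also have "\<dots> = (\<Prod>i<?n. gs ! i \<bullet> gs ! i)"
    by (simp add: prod_list_diag_prod mat_diag_def lessThan_atLeast0)
  finally have "basis_det m bs = sqrt (\<Prod>i<?n. gs ! i \<bullet> gs ! i)" by (simp add: basis_det_def)
  also have "\<dots> = (\<Prod>i<?n. vec_norm (gs ! i))"
    by (simp add: vec_norm_def sqrt_prod)
  also have "\<dots> = prod_list (map vec_norm gs)"
    by (simp add: prod.list_conv_set_nth gs(1) lessThan_atLeast0)
  finally show ?thesis by (simp add: gs_def)
qed

section \<open>The lower bound\<close>

text \<open>The projection of \<open>u\<close> to the line through \<open>w\<close> is \<open>c w\<close>, and a projection is no longer
  than the vector itself.\<close>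

lemma norm_le_if_scalar_prod_multiple:
  assumes u: "u \<in> carrier_vec m" and w: "w \<in> carrier_vec m"
    and uw: "u \<bullet> w = c * (w \<bullet> w)" and c: "1 \<le> \<bar>c\<bar>"
  shows "vec_norm w \<le> vec_norm u"
proof -
  have nonneg: "v \<bullet> v \<ge> 0" for v :: "real vec" by (simp add: scalar_prod_def sum_nonneg)
  have "w \<bullet> u = u \<bullet> w" using u w by (rule comm_scalar_prod[symmetric])
  then have "(u - c \<cdot>\<^sub>v w) \<bullet> (u - c \<cdot>\<^sub>v w) = u \<bullet> u - c\<^sup>2 * (w \<bullet> w)"
    using u w uw
    by (simp add: minus_scalar_prod_distrib[of _ m] scalar_prod_minus_distrib[of _ m]
        power2_eq_square algebra_simps)
  then have "c\<^sup>2 * (w \<bullet> w) \<le> u \<bullet> u" using nonneg by (metis diff_ge_0_iff_ge)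
  moreover have "1 \<le> c\<^sup>2" using c by (metis one_le_power power2_abs)
  then have "w \<bullet> w \<le> c\<^sup>2 * (w \<bullet> w)" using nonneg[of w] by (simp add: mult_le_cancel_right1)
  ultimately show ?thesis by (simp add: vec_norm_def)
qed

text \<open>The induction on the basis of the lattice. A witness \<open>js\<close> is more convenient than the minimum,
  because it extends from \<open>bs\<close> to \<open>bs @ [b]\<close>, either unchanged or by the new last index.\<close>

lemma sublattice_det_lower_bound:
  assumes "lin_indep_list m bs" "lin_indep_list m ds" "set ds \<subseteq> lattice_of m bs"
  shows "\<exists>js. length js = length ds \<and> sorted_wrt (<) js \<and> set js \<subseteq> {..<length bs} \<and>
    prod_list (map (\<lambda>i. vec_norm (gram_schmidt m bs ! i)) js) \<le> basis_det m ds"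
  using assms
proof (induction bs arbitrary: ds rule: rev_induct)
  case Nil
  then have "ds = []"
    using lin_indep_list_nonzero[of m ds] by (cases ds) (auto simp: lattice_of_Nil)
  then show ?case using basis_det_eq_prod_norms[OF Nil.prems(2)] by (simp add: gram_schmidt_def)
next
  case (snoc b bs)
  let ?n = "length bs" and ?bs = "bs @ [b]"
  define gs where "gs = gram_schmidt m ?bs"
  define w where "w = gs ! ?n"
  have bsc: "set ?bs \<subseteq> carrier_vec m" using snoc.prems by (simp add: lin_indep_list_def)
  then have bsc': "set bs \<subseteq> carrier_vec m" by simp
  have bs: "lin_indep_list m bs" using snoc.prems(1) by (rule lin_indep_list_append1)
  have gs_bs: "gs ! i = gram_schmidt m bs ! i" if "i < ?n" for i
    using that gram_schmidt_carrier[of bs m] bsc by (simp add: gs_def gram_schmidt_snoc nth_append)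
  have prod_gs_bs: "prod_list (map (\<lambda>i. vec_norm (gs ! i)) js)
      = prod_list (map (\<lambda>i. vec_norm (gram_schmidt m bs ! i)) js)" if "set js \<subseteq> {..<?n}" for js
    using that by (intro arg_cong[where f = prod_list]) (auto simp: gs_bs)
  have w: "w \<in> carrier_vec m"
    unfolding w_def gs_def by (rule gram_schmidt_nth_carrier[OF bsc]) simp
  have ww: "w \<bullet> w \<noteq> 0"
    using gram_schmidt_orthogonal[OF snoc.prems(1), of ?n ?n] by (simp add: w_def gs_def)
  have bw: "b \<bullet> w = w \<bullet> w"
    using scalar_prod_later_gram_schmidt[OF snoc.prems(1), of ?n ?n] by (simp add: w_def gs_def)
  have bsw: "v \<bullet> w = 0" if v: "v \<in> lattice_of m bs" for v
  proof -
    have "bs ! i \<bullet> w = 0" if "i < ?n" for i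
      using scalar_prod_later_gram_schmidt[OF snoc.prems(1), of i ?n]
        gram_schmidt_orthogonal[OF snoc.prems(1), of i ?n] that
      by (simp add: w_def gs_def nth_append)
    moreover have "bs ! i \<in> carrier_vec m" if "i < ?n" for i
      using bsc that by auto
    ultimately have z: "(mat_of_cols m bs)\<^sup>T *\<^sub>v w = 0\<^sub>v ?n"
      by (intro eq_vecI) (auto simp: col_mat_of_cols)
    obtain l :: "nat \<Rightarrow> int" where "v = mat_of_cols m bs *\<^sub>v vec ?n (\<lambda>i. of_int (l i))"
      using lattice_of_memE[OF bsc' v] by metis
    moreover have "w \<bullet> (mat_of_cols m bs *\<^sub>v vec ?n (\<lambda>i. of_int (l i))) = 0"
      using transpose_vec_mult_scalar[of "mat_of_cols m bs" m ?n "vec ?n (\<lambda>i. of_int (l i))" w] w z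
      by simp
    ultimately show ?thesis using w by (subst comm_scalar_prod[of _ m]) (auto intro!: carrier_vecI)
  qed
  \<comment> \<open>The coefficient of \<^term>\<open>b\<close> in a lattice vector is read off from the product with \<^term>\<open>w\<close>.\<close>
  have split: "\<exists>u c. v = u + of_int c \<cdot>\<^sub>v b \<and> u \<in> lattice_of m bs \<and> v \<bullet> w = of_int c * (w \<bullet> w)"
    if v: "v \<in> lattice_of m ?bs" for v
  proof -
    obtain u c where u: "u \<in> lattice_of m bs" "v = u + of_int c \<cdot>\<^sub>v b"
      using lattice_of_snocE[OF bsc v] by metis
    moreover have "u \<in> carrier_vec m" using u lattice_of_carrier[of bs m] bsc by auto
    ultimately show ?thesis
      using bsw[OF u(1)] bw bsc w
      by (intro exI[of _ u] exI[of _ c]) (auto simp: add_scalar_prod_distrib[of _ m])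
  qed
  have perp: "v \<in> lattice_of m bs" if v: "v \<in> lattice_of m ?bs" "v \<bullet> w = 0" for v
  proof -
    obtain u c where u: "v = u + of_int c \<cdot>\<^sub>v b" "u \<in> lattice_of m bs" "v \<bullet> w = of_int c * (w \<bullet> w)"
      using split[OF v(1)] by blast
    then have "c = 0" using v ww by simp
    moreover have "u \<in> carrier_vec m" using u lattice_of_carrier[of bs m] bsc by auto
    ultimately have "v = u" using u bsc by (intro eq_vecI) auto
    then show ?thesis using u by simp
  qed

  have dsc: "set ds \<subseteq> carrier_vec m" using snoc.prems by (simp add: lin_indep_list_def)
  have Lds: "lattice_of m ds \<subseteq> lattice_of m ?bs"
    using lattice_of_subset[OF dsc bsc] snoc.prems by blast
  \<comment> \<open>Scaled so that the product with a lattice vector is its integer coefficient of \<^term>\<open>b\<close>.\<close>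
  let ?w = "inverse (w \<bullet> w) \<cdot>\<^sub>v w"
  have scaled: "v \<bullet> ?w = inverse (w \<bullet> w) * (v \<bullet> w)" if "v \<in> carrier_vec m" for v
    using that w by simp
  have Lc: "lattice_of m ?bs \<subseteq> carrier_vec m" by (rule lattice_of_carrier[OF bsc])
  have int: "v \<bullet> ?w \<in> \<int>" if "v \<in> lattice_of m ds" for v
  proof -
    have v: "v \<in> lattice_of m ?bs" "v \<in> carrier_vec m" using that Lds Lc by auto
    obtain c where "v \<bullet> w = of_int c * (w \<bullet> w)" using split[OF v(1)] by blast
    then show ?thesis using ww scaled[OF v(2)] by (simp add: field_simps)
  qed
  have dsb: "lattice_basis m (lattice_of m ds) ds"
    using snoc.prems by (simp add: lattice_basis_def)
  obtain es where es: "lattice_basis m (lattice_of m ds) es" "length es = length ds"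
    and esw: "\<And>e. e \<in> set (butlast es) \<Longrightarrow> e \<bullet> ?w = 0"
    using lattice_basis_concentrate[OF dsb _ int] w by auto
  have esi: "lin_indep_list m es" and esL: "set es \<subseteq> lattice_of m ?bs"
    using es Lds set_subset_lattice_of[of es m] by (auto simp: lattice_basis_def lin_indep_list_def)
  have det: "basis_det m es = basis_det m ds" using basis_det_unique[OF es(1) dsb] .
  show ?case
  proof (cases "\<forall>e\<in>set es. e \<bullet> w = 0")
    case True
    then have "set es \<subseteq> lattice_of m bs" using perp esL by blast
    from snoc.IH[OF bs esi this] obtain js where js: "length js = length es" "sorted_wrt (<) js"
      "set js \<subseteq> {..<?n}" "prod_list (map (\<lambda>i. vec_norm (gram_schmidt m bs ! i)) js) \<le> basis_det m es"
      by blast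
    have "prod_list (map (\<lambda>i. vec_norm (gs ! i)) js) \<le> basis_det m ds"
      using js(4) det by (simp add: prod_gs_bs[OF js(3)])
    moreover have "set js \<subseteq> {..<length ?bs}" using js(3) by auto
    ultimately show ?thesis using js(1,2) es(2) unfolding gs_def by auto
  next
    case False
    then have "es \<noteq> []" by auto
    then obtain fs d where fd: "es = fs @ [d]" by (metis append_butlast_last_id)
    have fsi: "lin_indep_list m fs" using esi fd lin_indep_list_append1 by blast
    have esc: "set es \<subseteq> carrier_vec m" using esi by (simp add: lin_indep_list_def)
    have fsw: "f \<bullet> w = 0" if "f \<in> set fs" for f
      using esw[of f] scaled[of f] that ww esc fd by auto
    then have dw: "d \<bullet> w \<noteq> 0" using False fd by auto
    have "set fs \<subseteq> lattice_of m bs" using perp fsw esL fd by auto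
    from snoc.IH[OF bs fsi this] obtain js where js: "length js = length fs" "sorted_wrt (<) js"
      "set js \<subseteq> {..<?n}" "prod_list (map (\<lambda>i. vec_norm (gram_schmidt m bs ! i)) js) \<le> basis_det m fs"
      by blast
    define u where "u = gram_schmidt m es ! length fs"
    have u: "u \<in> carrier_vec m"
      unfolding u_def using fd by (intro gram_schmidt_nth_carrier[OF esc]) simp
    obtain c where c: "d \<bullet> w = of_int c * (w \<bullet> w)" using split[of d] esL fd by auto
    have "u \<bullet> w = d \<bullet> w"
      unfolding u_def using fsw fd
      by (subst gram_schmidt_scalar_prod_perp[OF esc w]) (auto simp: nth_append)
    then have uw: "vec_norm w \<le> vec_norm u"
      using c dw by (intro norm_le_if_scalar_prod_multiple[OF u w, of "of_int c"]) auto
    have gs_es: "gram_schmidt m es = gram_schmidt m fs @ [u]"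
      using gram_schmidt_carrier[of fs m] esc fd by (simp add: u_def gram_schmidt_snoc nth_append)
    have "prod_list (map (\<lambda>i. vec_norm (gs ! i)) (js @ [?n]))
        = prod_list (map (\<lambda>i. vec_norm (gram_schmidt m bs ! i)) js) * vec_norm w"
      by (simp add: w_def prod_gs_bs[OF js(3)])
    also have "\<dots> \<le> basis_det m fs * vec_norm u"
      using js(4) uw
      by (intro mult_mono) (auto simp: basis_det_eq_prod_norms[OF fsi] vec_norm_def scalar_prod_def
          intro!: prod_list_nonneg sum_nonneg)
    also have "\<dots> = basis_det m es"
      by (simp add: basis_det_eq_prod_norms fsi esi gs_es)
    finally have "prod_list (map (\<lambda>i. vec_norm (gs ! i)) (js @ [?n])) \<le> basis_det m ds"
      by (simp add: det)
    moreover have "sorted_wrt (<) (js @ [?n])" using js by (auto simp: sorted_wrt_append)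
    moreover have "length (js @ [?n]) = length ds" using js es fd by simp
    moreover have "set (js @ [?n]) \<subseteq> {..<length ?bs}" using js(3) by auto
    ultimately show ?thesis unfolding gs_def by blast
  qed
qed

theorem lemma1:
  fixes m :: nat and L :: "real vec set" and ds bs :: "real vec list"
  assumes "is_lattice m L"
    and "lin_indep_list m ds" and "set ds \<subseteq> L"
    and "lattice_basis m L bs"
  shows "lattice_det m (lattice_of m ds) \<ge>
    Min {prod_list (map (\<lambda>i. vec_norm (gram_schmidt m bs ! i)) js) | js :: nat list.
           length js = length ds \<and> sorted_wrt (<) js \<and> set js \<subseteq> {..<length bs}}"
    (is "_ \<ge> Min ?S")
proof -
  let ?J = "{js :: nat list. set js \<subseteq> {..<length bs} \<and> length js = length ds}"
  have "?S \<subseteq> (\<lambda>js. prod_list (map (\<lambda>i. vec_norm (gram_schmidt m bs ! i)) js)) ` ?J" by auto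
  then have fin: "finite ?S" by (rule finite_subset) (simp add: finite_lists_length_eq)
  have "lin_indep_list m bs" "set ds \<subseteq> lattice_of m bs"
    using assms by (simp_all add: lattice_basis_def)
  from sublattice_det_lower_bound[OF this(1) assms(2) this(2)]
  obtain x where "x \<in> ?S" "x \<le> basis_det m ds" by blast
  then have "Min ?S \<le> basis_det m ds" using fin by (meson Min_le order_trans)
  also have "basis_det m ds = lattice_det m (lattice_of m ds)"
    using assms(2) by (intro lattice_det_eq[symmetric]) (simp add: lattice_basis_def)
  finally show ?thesis .
qed

end
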